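(* Let $K$ be a field, $\lambda\in K$. Let $(A,\mu,1,\alpha_A,\beta_A,\psi_A,\omega_A,r)$ be a quasitriangular unitary $\lambda$-infBH-bialgebra, $r=r^1\otimes r^2$, and let $(M,\triangleright,\triangleleft,\alpha_M,\beta_M)$ be an $(A,\mu,\alpha_A,\beta_A)$-bimodule with $\alpha_M,\beta_M$ invertible. Define $$R_A(a)=-\beta_A^2\psi_A(r^1)\big(\alpha_A^{-1}\beta_A^{-1}(a)\,\alpha_A\omega_A(r^2)\big),\qquad R_M(m)=-\beta_A^2\psi_A(r^1)\triangleright\big(\alpha_M^{-1}\beta_M^{-1}(m)\triangleleft\alpha_A\omega_A(r^2)\big)$$ for $a\in A$, $m\in M$. Then $(M,\triangleright,\triangleleft,\alpha_M,\beta_M,R_M)$ is a $\lambda$-Rota-Baxter BiHom-bimodule on the $\lambda$-Rota-Baxter BiHom-associative algebra $(A,\mu,\alpha_A,\beta_A,R_A)$.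
   Context: Everything is over the field $K$. BiHom-associative algebra $(A,\mu,\alpha,\beta)$: linear $\mu$ (written $ab$), $\alpha,\beta:A\to A$ with $\alpha\beta=\beta\alpha$, $\alpha,\beta$ multiplicative, $\alpha(a)(bc)=(ab)\beta(c)$. Unitary: there is $1\in A$ with $\alpha(1)=\beta(1)=1$, $a1=\alpha(a)$, $1a=\beta(a)$. Bimodule $(M,\triangleright,\triangleleft,\alpha_M,\beta_M)$: $\alpha_M\beta_M=\beta_M\alpha_M$; $f_M(a\triangleright m)=f_A(a)\triangleright f_M(m)$ and $f_M(m\triangleleft a)=f_M(m)\triangleleft f_A(a)$ for $f\in\{\alpha,\beta\}$; $\alpha_A(a)\triangleright(a'\triangleright m)=(aa')\triangleright\beta_M(m)$; $\alpha_M(m)\triangleleft(aa')=(m\triangleleft a)\triangleleft\beta_A(a')$; $\alpha_A(a)\triangleright(m\triangleleft a')=(a\triangleright m)\triangleleft\beta_A(a')$. Quasitriangular unitary $\lambda$-infBH-bialgebra $(A,\mu,1,\alpha,\beta,\psi,\omega,r)$: $(A,\mu,1,\alpha,\beta)$ is a unitary BiHom-associative algebra with $\alpha,\beta$ bijective; $\psi,\omega:A\to A$ are linear, multiplicative, commute with each other and with $\alpha,\beta$, and fix $1$; $r=r^1\otimes r^2\in A\otimes A$ (summation understood) is invariant under $f\otimes f$ for $f\in\{\alpha,\beta,\psi,\omega\}$; and, with $\bar r=\bar r^1\otimes\bar r^2$ a second copy of $r$, $$\omega(r^1)\bar r^1\otimes\beta(\bar r^2)\otimes\alpha\psi(r^2)-\alpha(r^1)\otimes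 r^2\bar r^1\otimes\beta(\bar r^2)+\beta\omega(r^1)\otimes\alpha(\bar r^1)\otimes\bar r^2\psi(r^2)=\lambda\,\omega(r^1)\otimes1\otimes\psi(r^2).$$ (Its comultiplication is $\Delta_r(a)=\omega\alpha^{-1}(a)r^1\otimes\beta(r^2)-\alpha(r^1)\otimes r^2\psi\beta^{-1}(a)-\lambda\,\omega(a)\otimes1$.) $\lambda$-Rota-Baxter BiHom-associative algebra $(A,\mu,\alpha,\beta,R)$: BiHom-associative algebra with linear $R$ commuting with $\alpha,\beta$ and $R(a)R(b)=R(aR(b))+R(R(a)b)+\lambda R(ab)$. $\lambda$-Rota-Baxter BiHom-bimodule $(M,\triangleright,\triangleleft,\alpha_M,\beta_M,R_M)$ on $(A,\mu,\alpha_A,\beta_A,R_A)$: a bimodule with linear $R_M$ commuting with $\alpha_M,\beta_M$ and $R_A(a)\triangleright R_M(m)=R_M(a\triangleright R_M(m)+R_A(a)\triangleright m+\lambda a\triangleright m)$, $R_M(m)\triangleleft R_A(a)=R_M(m\triangleleft R_A(a)+R_M(m)\triangleleft a+\lambda m\triangleleft a)$. *)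

theory Defs
  imports Complex_Main "HOL-Library.Poly_Mapping"
begin

definition free_scale :: "'k::field \<Rightarrow> ('x \<Rightarrow>\<^sub>0 'k) \<Rightarrow> ('x \<Rightarrow>\<^sub>0 'k)" where
  "free_scale c p = Poly_Mapping.map ((*) c) p"

lemma lookup_free_scale [simp]: "Poly_Mapping.lookup (free_scale c p) x = c * Poly_Mapping.lookup p x"
  by (simp add: free_scale_def Poly_Mapping.map.rep_eq when_def)

global_interpretation free_vs: vector_space free_scale
  by unfold_locales (auto intro!: poly_mapping_eqI simp: lookup_add algebra_simps)

definition pure2 :: "'a \<Rightarrow> 'a \<Rightarrow> ('a \<times> 'a \<Rightarrow>\<^sub>0 'k::field)" where
  "pure2 x y = Poly_Mapping.single (x, y) 1"

definition pure3 :: "'a \<Rightarrow> 'a \<Rightarrow> 'a \<Rightarrow> ('a \<times> 'a \<times> 'a \<Rightarrow>\<^sub>0 'k::field)" where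
  "pure3 x y z = Poly_Mapping.single (x, y, z) 1"

definition tensor2_null ::
    "('k::field \<Rightarrow> 'a::ab_group_add \<Rightarrow> 'a) \<Rightarrow> ('a \<times> 'a \<Rightarrow>\<^sub>0 'k) set" where
  "tensor2_null s = free_vs.span
    ({pure2 (x + x') y - pure2 x y - pure2 x' y | x x' y. True} \<union>
     {pure2 x (y + y') - pure2 x y - pure2 x y' | x y y'. True} \<union>
     {pure2 (s c x) y - free_scale c (pure2 x y) | c x y. True} \<union>
     {pure2 x (s c y) - free_scale c (pure2 x y) | c x y. True})"

definition tensor3_null ::
    "('k::field \<Rightarrow> 'a::ab_group_add \<Rightarrow> 'a) \<Rightarrow> ('a \<times> 'a \<times> 'a \<Rightarrow>\<^sub>0 'k) set" where
  "tensor3_null s = free_vs.span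
    ({pure3 (x + x') y z - pure3 x y z - pure3 x' y z | x x' y z. True} \<union>
     {pure3 x (y + y') z - pure3 x y z - pure3 x y' z | x y y' z. True} \<union>
     {pure3 x y (z + z') - pure3 x y z - pure3 x y z' | x y z z'. True} \<union>
     {pure3 (s c x) y z - free_scale c (pure3 x y z) | c x y z. True} \<union>
     {pure3 x (s c y) z - free_scale c (pure3 x y z) | c x y z. True} \<union>
     {pure3 x y (s c z) - free_scale c (pure3 x y z) | c x y z. True})"

text \<open>
  The vector space structure is a parameter \<open>s\<close> rather than a type class, so \<open>A \<otimes> A\<close> and
  \<open>A \<otimes> A \<otimes> A\<close> cannot be types: their elements are the cosets of the null spaces above.
\<close>

definition tensor2_class ::
    "('k::field \<Rightarrow> 'a::ab_group_add \<Rightarrow> 'a) \<Rightarrow> ('a \<times> 'a \<Rightarrow>\<^sub>0 'k) \<Rightarrow> ('a \<times> 'a \<Rightarrow>\<^sub>0 'k) set" where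
  "tensor2_class s p = {q. q - p \<in> tensor2_null s}"

definition tensor3_class ::
    "('k::field \<Rightarrow> 'a::ab_group_add \<Rightarrow> 'a) \<Rightarrow> ('a \<times> 'a \<times> 'a \<Rightarrow>\<^sub>0 'k) \<Rightarrow> ('a \<times> 'a \<times> 'a \<Rightarrow>\<^sub>0 'k) set" where
  "tensor3_class s p = {q. q - p \<in> tensor3_null s}"

definition tensor2 :: "('k::field \<Rightarrow> 'a::ab_group_add \<Rightarrow> 'a) \<Rightarrow> ('a \<times> 'a \<Rightarrow>\<^sub>0 'k) set set" where
  "tensor2 s = range (tensor2_class s)"

definition lin_ext ::
    "('k::field \<Rightarrow> 'b::ab_group_add \<Rightarrow> 'b) \<Rightarrow> ('x \<Rightarrow> 'b) \<Rightarrow> ('x \<Rightarrow>\<^sub>0 'k) \<Rightarrow> 'b" where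
  "lin_ext t f p = (\<Sum>x\<in>Poly_Mapping.keys p. t (Poly_Mapping.lookup p x) (f x))"

text \<open>
  \<open>sweedler t F r\<close> is the sum \<open>F r\<^sup>1 r\<^sup>2\<close> of Sweedler-type notation, for
  \<open>r = r\<^sup>1 \<otimes> r\<^sup>2\<close> (summation understood) and values of \<open>F\<close> in the vector space \<open>t\<close>.
  By lemma \<open>sweedler_class\<close> below it does not depend on the chosen representative when \<open>F\<close> is
  bilinear. In \<open>tensor2_map\<close> and in the Yang-Baxter equation below, \<open>F\<close> takes values in a free
  vector space and is bilinear modulo the null space only; lemma \<open>sweedler_class_mod\<close> then gives
  independence of the class.
\<close>

definition sweedler ::
    "('k::field \<Rightarrow> 'b::ab_group_add \<Rightarrow> 'b) \<Rightarrow> ('a \<Rightarrow> 'a \<Rightarrow> 'b) \<Rightarrow> ('a \<times> 'a \<Rightarrow>\<^sub>0 'k) set \<Rightarrow> 'b" where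
  "sweedler t F r = lin_ext t (\<lambda>(x, y). F x y) (SOME p. p \<in> r)"

definition tensor2_map ::
    "('k::field \<Rightarrow> 'a::ab_group_add \<Rightarrow> 'a) \<Rightarrow> ('a \<Rightarrow> 'a) \<Rightarrow> ('a \<Rightarrow> 'a) \<Rightarrow>
      ('a \<times> 'a \<Rightarrow>\<^sub>0 'k) set \<Rightarrow> ('a \<times> 'a \<Rightarrow>\<^sub>0 'k) set" where
  "tensor2_map s f g r = tensor2_class s (sweedler free_scale (\<lambda>x y. pure2 (f x) (g y)) r)"

definition bilinear_map ::
    "('k::field \<Rightarrow> 'a::ab_group_add \<Rightarrow> 'a) \<Rightarrow> ('k \<Rightarrow> 'b::ab_group_add \<Rightarrow> 'b) \<Rightarrow>
      ('k \<Rightarrow> 'c::ab_group_add \<Rightarrow> 'c) \<Rightarrow> ('a \<Rightarrow> 'b \<Rightarrow> 'c) \<Rightarrow> bool" where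
  "bilinear_map s1 s2 s3 f \<longleftrightarrow>
    (\<forall>x. Vector_Spaces.linear s2 s3 (f x)) \<and> (\<forall>y. Vector_Spaces.linear s1 s3 (\<lambda>x. f x y))"

context vector_space
begin

lemma lin_ext_superset:
  assumes "finite S" "Poly_Mapping.keys p \<subseteq> S"
  shows "lin_ext scale f p = (\<Sum>x\<in>S. scale (Poly_Mapping.lookup p x) (f x))"
  unfolding lin_ext_def using assms
  by (intro sum.mono_neutral_left) (auto simp: in_keys_iff)

lemma linear_lin_ext: "Vector_Spaces.linear free_scale scale (lin_ext scale f)"
proof -
  have add: "lin_ext scale f (p + q) = lin_ext scale f p + lin_ext scale f q" for p q
  proof -
    let ?S = "Poly_Mapping.keys p \<union> Poly_Mapping.keys q"
    have "Poly_Mapping.keys (p + q) \<subseteq> ?S" by (rule Poly_Mapping.keys_add)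
    then show ?thesis
      by (simp add: lin_ext_superset[of ?S] lookup_add scale_left_distrib sum.distrib)
  qed
  have "lin_ext scale f (free_scale c p) = scale c (lin_ext scale f p)" for c p
  proof -
    let ?S = "Poly_Mapping.keys p"
    have "Poly_Mapping.keys (free_scale c p) \<subseteq> ?S" by (auto simp: in_keys_iff)
    then show ?thesis
      by (simp add: lin_ext_superset[of ?S] scale_sum_right)
  qed
  with add show ?thesis
    by unfold_locales (auto simp: algebra_simps)
qed

lemma lin_ext_single [simp]: "lin_ext scale f (Poly_Mapping.single x 1) = f x"
  by (simp add: lin_ext_def)

lemma lin_ext_null:
  assumes N: "subspace N"
    and "\<And>x x' y. F (x + x') y - F x y - F x' y \<in> N"
    and "\<And>x y y'. F x (y + y') - F x y - F x y' \<in> N"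
    and "\<And>c x y. F (s c x) y - scale c (F x y) \<in> N"
    and "\<And>c x y. F x (s c y) - scale c (F x y) \<in> N"
    and p: "p \<in> tensor2_null s"
  shows "lin_ext scale (\<lambda>(x, y). F x y) p \<in> N"
proof -
  interpret L: Vector_Spaces.linear free_scale scale "lin_ext scale (\<lambda>(x, y). F x y)"
    by (rule linear_lin_ext)
  have "free_vs.subspace {p. lin_ext scale (\<lambda>(x, y). F x y) p \<in> N}"
    using N by (rule L.subspace_linear_preimage)
  then have "tensor2_null s \<subseteq> {p. lin_ext scale (\<lambda>(x, y). F x y) p \<in> N}"
    unfolding tensor2_null_def using assms(2-5)
    by (intro free_vs.span_minimal) (auto simp: pure2_def L.diff L.scale)
  with p show ?thesis by auto
qed

lemma sweedler_class_mod:
  assumes "subspace N"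
    and "\<And>x x' y. F (x + x') y - F x y - F x' y \<in> N"
    and "\<And>x y y'. F x (y + y') - F x y - F x y' \<in> N"
    and "\<And>c x y. F (s c x) y - scale c (F x y) \<in> N"
    and "\<And>c x y. F x (s c y) - scale c (F x y) \<in> N"
  shows "sweedler scale F (tensor2_class s p) - lin_ext scale (\<lambda>(x, y). F x y) p \<in> N"
proof -
  interpret L: Vector_Spaces.linear free_scale scale "lin_ext scale (\<lambda>(x, y). F x y)"
    by (rule linear_lin_ext)
  have "p \<in> tensor2_class s p"
    by (simp add: tensor2_class_def tensor2_null_def free_vs.span_zero)
  then have "(SOME q. q \<in> tensor2_class s p) \<in> tensor2_class s p"
    by (rule someI)
  then have "(SOME q. q \<in> tensor2_class s p) - p \<in> tensor2_null s"
    by (simp add: tensor2_class_def)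
  from lin_ext_null[OF assms this] show ?thesis
    by (simp add: sweedler_def L.diff)
qed

lemma sweedler_class:
  assumes "bilinear_map s s scale F"
  shows "sweedler scale F (tensor2_class s p) = lin_ext scale (\<lambda>(x, y). F x y) p"
proof -
  have l: "Vector_Spaces.linear s scale (F x)" "Vector_Spaces.linear s scale (\<lambda>x. F x y)" for x y
    using assms by (auto simp: bilinear_map_def)
  have "sweedler scale F (tensor2_class s p) - lin_ext scale (\<lambda>(x, y). F x y) p \<in> {0}"
    using l by (intro sweedler_class_mod) (auto simp: Vector_Spaces.linear_iff)
  then show ?thesis by simp
qed

end

locale bihom_assoc_algebra = vector_space scale
  for scale :: "'k::field \<Rightarrow> 'a::ab_group_add \<Rightarrow> 'a" +
  fixes mult :: "'a \<Rightarrow> 'a \<Rightarrow> 'a" (infixl \<open>\<cdot>\<close> 70)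
    and \<alpha> \<beta> :: "'a \<Rightarrow> 'a"
  assumes mult_bilinear: "bilinear_map scale scale scale mult"
    and \<alpha>_linear: "Vector_Spaces.linear scale scale \<alpha>"
    and \<beta>_linear: "Vector_Spaces.linear scale scale \<beta>"
    and \<alpha>_\<beta>_commute: "\<alpha> (\<beta> a) = \<beta> (\<alpha> a)"
    and \<alpha>_mult: "\<alpha> (a \<cdot> b) = \<alpha> a \<cdot> \<alpha> b"
    and \<beta>_mult: "\<beta> (a \<cdot> b) = \<beta> a \<cdot> \<beta> b"
    and bihom_assoc: "\<alpha> a \<cdot> (b \<cdot> c) = (a \<cdot> b) \<cdot> \<beta> c"

locale unitary_bihom_assoc_algebra = bihom_assoc_algebra scale mult \<alpha> \<beta>
  for scale :: "'k::field \<Rightarrow> 'a::ab_group_add \<Rightarrow> 'a"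
    and mult :: "'a \<Rightarrow> 'a \<Rightarrow> 'a" (infixl \<open>\<cdot>\<close> 70)
    and e :: 'a
    and \<alpha> \<beta> :: "'a \<Rightarrow> 'a" +
  assumes \<alpha>_unit: "\<alpha> e = e"
    and \<beta>_unit: "\<beta> e = e"
    and mult_unit_right: "a \<cdot> e = \<alpha> a"
    and mult_unit_left: "e \<cdot> a = \<beta> a"

locale bihom_bimodule = A: bihom_assoc_algebra scaleA mult \<alpha>A \<beta>A + M: vector_space scaleM
  for scaleA :: "'k::field \<Rightarrow> 'a::ab_group_add \<Rightarrow> 'a"
    and mult :: "'a \<Rightarrow> 'a \<Rightarrow> 'a" (infixl \<open>\<cdot>\<close> 70)
    and \<alpha>A \<beta>A :: "'a \<Rightarrow> 'a"
    and scaleM :: "'k \<Rightarrow> 'm::ab_group_add \<Rightarrow> 'm" +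
  fixes lact :: "'a \<Rightarrow> 'm \<Rightarrow> 'm" (infixr \<open>\<triangleright>\<close> 70)
    and ract :: "'m \<Rightarrow> 'a \<Rightarrow> 'm" (infixl \<open>\<triangleleft>\<close> 70)
    and \<alpha>M \<beta>M :: "'m \<Rightarrow> 'm"
  assumes lact_bilinear: "bilinear_map scaleA scaleM scaleM lact"
    and ract_bilinear: "bilinear_map scaleM scaleA scaleM ract"
    and \<alpha>M_linear: "Vector_Spaces.linear scaleM scaleM \<alpha>M"
    and \<beta>M_linear: "Vector_Spaces.linear scaleM scaleM \<beta>M"
    and \<alpha>M_\<beta>M_commute: "\<alpha>M (\<beta>M m) = \<beta>M (\<alpha>M m)"
    and \<alpha>M_lact: "\<alpha>M (a \<triangleright> m) = \<alpha>A a \<triangleright> \<alpha>M m"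
    and \<beta>M_lact: "\<beta>M (a \<triangleright> m) = \<beta>A a \<triangleright> \<beta>M m"
    and \<alpha>M_ract: "\<alpha>M (m \<triangleleft> a) = \<alpha>M m \<triangleleft> \<alpha>A a"
    and \<beta>M_ract: "\<beta>M (m \<triangleleft> a) = \<beta>M m \<triangleleft> \<beta>A a"
    and lact_lact: "\<alpha>A a \<triangleright> (a' \<triangleright> m) = (a \<cdot> a') \<triangleright> \<beta>M m"
    and ract_ract: "\<alpha>M m \<triangleleft> (a \<cdot> a') = (m \<triangleleft> a) \<triangleleft> \<beta>A a'"
    and lact_ract: "\<alpha>A a \<triangleright> (m \<triangleleft> a') = (a \<triangleright> m) \<triangleleft> \<beta>A a'"

locale quasitriangular_infBH_bialgebra = unitary_bihom_assoc_algebra scale mult e \<alpha> \<beta>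
  for lam :: "'k::field"
    and scale :: "'k \<Rightarrow> 'a::ab_group_add \<Rightarrow> 'a"
    and mult :: "'a \<Rightarrow> 'a \<Rightarrow> 'a" (infixl \<open>\<cdot>\<close> 70)
    and e :: 'a
    and \<alpha> \<beta> :: "'a \<Rightarrow> 'a" +
  fixes \<psi> \<omega> :: "'a \<Rightarrow> 'a"
    and r :: "('a \<times> 'a \<Rightarrow>\<^sub>0 'k) set"
  assumes \<alpha>_bij: "bij \<alpha>"
    and \<beta>_bij: "bij \<beta>"
    and \<psi>_linear: "Vector_Spaces.linear scale scale \<psi>"
    and \<omega>_linear: "Vector_Spaces.linear scale scale \<omega>"
    and \<psi>_mult: "\<psi> (a \<cdot> b) = \<psi> a \<cdot> \<psi> b"
    and \<omega>_mult: "\<omega> (a \<cdot> b) = \<omega> a \<cdot> \<omega> b"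
    and \<psi>_\<omega>_commute: "\<psi> (\<omega> a) = \<omega> (\<psi> a)"
    and \<psi>_\<alpha>_commute: "\<psi> (\<alpha> a) = \<alpha> (\<psi> a)"
    and \<psi>_\<beta>_commute: "\<psi> (\<beta> a) = \<beta> (\<psi> a)"
    and \<omega>_\<alpha>_commute: "\<omega> (\<alpha> a) = \<alpha> (\<omega> a)"
    and \<omega>_\<beta>_commute: "\<omega> (\<beta> a) = \<beta> (\<omega> a)"
    and \<psi>_unit: "\<psi> e = e"
    and \<omega>_unit: "\<omega> e = e"
    and r_tensor: "r \<in> tensor2 scale"
    and r_\<alpha>_invariant: "tensor2_map scale \<alpha> \<alpha> r = r"
    and r_\<beta>_invariant: "tensor2_map scale \<beta> \<beta> r = r"
    and r_\<psi>_invariant: "tensor2_map scale \<psi> \<psi> r = r"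
    and r_\<omega>_invariant: "tensor2_map scale \<omega> \<omega> r = r"
    and yang_baxter:
      "tensor3_class scale
        (sweedler free_scale (\<lambda>r1 r2. sweedler free_scale (\<lambda>r1' r2'.
            pure3 (\<omega> r1 \<cdot> r1') (\<beta> r2') (\<alpha> (\<psi> r2))
            - pure3 (\<alpha> r1) (r2 \<cdot> r1') (\<beta> r2')
            + pure3 (\<beta> (\<omega> r1)) (\<alpha> r1') (r2' \<cdot> \<psi> r2)) r) r)
      = tensor3_class scale
        (free_scale lam (sweedler free_scale (\<lambda>r1 r2. pure3 (\<omega> r1) e (\<psi> r2)) r))"

locale rota_baxter_bihom_algebra = bihom_assoc_algebra scale mult \<alpha> \<beta>
  for lam :: "'k::field"
    and scale :: "'k \<Rightarrow> 'a::ab_group_add \<Rightarrow> 'a"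
    and mult :: "'a \<Rightarrow> 'a \<Rightarrow> 'a" (infixl \<open>\<cdot>\<close> 70)
    and \<alpha> \<beta> :: "'a \<Rightarrow> 'a" +
  fixes R :: "'a \<Rightarrow> 'a"
  assumes R_linear: "Vector_Spaces.linear scale scale R"
    and R_\<alpha>_commute: "R (\<alpha> a) = \<alpha> (R a)"
    and R_\<beta>_commute: "R (\<beta> a) = \<beta> (R a)"
    and rota_baxter: "R a \<cdot> R b = R (a \<cdot> R b) + R (R a \<cdot> b) + scale lam (R (a \<cdot> b))"

locale rota_baxter_bihom_bimodule =
  RA: rota_baxter_bihom_algebra lam scaleA mult \<alpha>A \<beta>A R\<^sub>A +
  bihom_bimodule scaleA mult \<alpha>A \<beta>A scaleM lact ract \<alpha>M \<beta>M
  for lam :: "'k::field"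
    and scaleA :: "'k \<Rightarrow> 'a::ab_group_add \<Rightarrow> 'a"
    and mult :: "'a \<Rightarrow> 'a \<Rightarrow> 'a" (infixl \<open>\<cdot>\<close> 70)
    and \<alpha>A \<beta>A :: "'a \<Rightarrow> 'a"
    and R\<^sub>A :: "'a \<Rightarrow> 'a"
    and scaleM :: "'k \<Rightarrow> 'm::ab_group_add \<Rightarrow> 'm"
    and lact :: "'a \<Rightarrow> 'm \<Rightarrow> 'm" (infixr \<open>\<triangleright>\<close> 70)
    and ract :: "'m \<Rightarrow> 'a \<Rightarrow> 'm" (infixl \<open>\<triangleleft>\<close> 70)
    and \<alpha>M \<beta>M :: "'m \<Rightarrow> 'm" +
  fixes R\<^sub>M :: "'m \<Rightarrow> 'm"
  assumes R\<^sub>M_linear: "Vector_Spaces.linear scaleM scaleM R\<^sub>M"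
    and R\<^sub>M_\<alpha>M_commute: "R\<^sub>M (\<alpha>M m) = \<alpha>M (R\<^sub>M m)"
    and R\<^sub>M_\<beta>M_commute: "R\<^sub>M (\<beta>M m) = \<beta>M (R\<^sub>M m)"
    and rota_baxter_left:
      "R\<^sub>A a \<triangleright> R\<^sub>M m = R\<^sub>M (a \<triangleright> R\<^sub>M m + R\<^sub>A a \<triangleright> m + scaleM lam (a \<triangleright> m))"
    and rota_baxter_right:
      "R\<^sub>M m \<triangleleft> R\<^sub>A a = R\<^sub>M (m \<triangleleft> R\<^sub>A a + R\<^sub>M m \<triangleleft> a + scaleM lam (m \<triangleleft> a))"

end

theory Submission
  imports Defs
begin

text \<open>
  Since \<open>\<alpha>\<close> and \<open>\<beta>\<close> are bijective, the product \<open>a \<star> b = \<alpha>\<^sup>-\<^sup>1(a) \<beta>\<^sup>-\<^sup>1(b)\<close> is associative with unit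
  \<open>e\<close>, and \<open>M\<close> becomes an ordinary bimodule over it. The invariance of \<open>r\<close> turns \<open>R\<close> into
  \<open>R(a) = - \<psi>(r\<^sup>1) \<star> a \<star> \<omega>(r\<^sup>2)\<close> and the Yang-Baxter equation, with \<open>s\<close> a second copy of \<open>r\<close>, into
  \<open>\<omega>(r\<^sup>1) \<star> s\<^sup>1 \<otimes> s\<^sup>2 \<otimes> \<psi>(r\<^sup>2) - r\<^sup>1 \<otimes> r\<^sup>2 \<star> s\<^sup>1 \<otimes> s\<^sup>2 + \<omega>(r\<^sup>1) \<otimes> s\<^sup>1 \<otimes> s\<^sup>2 \<star> \<psi>(r\<^sup>2)
    = \<lambda> \<omega>(r\<^sup>1) \<otimes> e \<otimes> \<psi>(r\<^sup>2)\<close>.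
  Applying \<open>\<psi>\<psi> \<otimes> \<omega>\<psi> \<otimes> \<omega>\<omega>\<close>, every copy of \<open>r\<close> reduces by invariance to \<open>\<psi>(r\<^sup>1) \<otimes> \<omega>(r\<^sup>2)\<close>
  (no inverse of \<open>\<psi>\<close> or \<open>\<omega>\<close> is needed); inserting \<open>a\<close> and \<open>m\<close> between the tensor factors then gives
  the Rota-Baxter identities. The identity for \<open>A\<close> is the case \<open>M = A\<close>.
\<close>

section \<open>Evaluating multilinear maps on tensor classes\<close>

definition trilinear_map ::
    "('k::field \<Rightarrow> 'a::ab_group_add \<Rightarrow> 'a) \<Rightarrow> ('k \<Rightarrow> 'b::ab_group_add \<Rightarrow> 'b) \<Rightarrow>
      ('a \<Rightarrow> 'a \<Rightarrow> 'a \<Rightarrow> 'b) \<Rightarrow> bool" where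
  "trilinear_map s t T \<longleftrightarrow>
    (\<forall>y z. Vector_Spaces.linear s t (\<lambda>x. T x y z)) \<and>
    (\<forall>x z. Vector_Spaces.linear s t (\<lambda>y. T x y z)) \<and>
    (\<forall>x y. Vector_Spaces.linear s t (\<lambda>z. T x y z))"

lemma lin_ext_linear_image:
  assumes "Vector_Spaces.linear t u h"
  shows "h (lin_ext t f p) = lin_ext u (\<lambda>x. h (f x)) p"
proof -
  interpret h: Vector_Spaces.linear t u h by fact
  show ?thesis by (simp add: lin_ext_def h.sum h.scale)
qed

text \<open>A Sweedler sum is a finite linear combination over one fixed representative, so linear
  maps pass inside it for every \<open>F\<close>, including the free-space valued \<open>F\<close>
  of the Yang-Baxter equation.\<close>

lemma sweedler_linear_image:
  assumes "Vector_Spaces.linear t u h"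
  shows "h (sweedler t F r) = sweedler u (\<lambda>x y. h (F x y)) r"
  by (simp add: sweedler_def lin_ext_linear_image[OF assms] case_prod_unfold)

context vector_space
begin

lemma sweedler_add:
  "sweedler scale (\<lambda>x y. F x y + G x y) r = sweedler scale F r + sweedler scale G r"
  by (simp add: sweedler_def lin_ext_def case_prod_unfold scale_right_distrib sum.distrib)

lemma sweedler_uminus: "sweedler scale (\<lambda>x y. - F x y) r = - sweedler scale F r"
  by (simp add: sweedler_def lin_ext_def case_prod_unfold sum_negf)

lemma sweedler_diff:
  "sweedler scale (\<lambda>x y. F x y - G x y) r = sweedler scale F r - sweedler scale G r"
  by (simp add: sweedler_def lin_ext_def case_prod_unfold scale_right_diff_distrib sum_subtractf)

lemma sweedler_scale:
  "sweedler scale (\<lambda>x y. scale c (F x y)) r = scale c (sweedler scale F r)"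
  by (simp add: sweedler_def lin_ext_def case_prod_unfold scale_sum_right mult.commute)

text \<open>Invariance lets \<open>r\<close> be replaced by the class of its image tensor
  \<open>?q\<close>. A bilinear \<open>F\<close> does not see the representative, so it may be
  evaluated at \<open>?q\<close> itself, where its linear extension passes inside the sum.\<close>

lemma sweedler_invariant:
  assumes inv: "tensor2_map s f g r = r"
    and F: "bilinear_map s s scale F"
  shows "sweedler scale (\<lambda>x y. F (f x) (g y)) r = sweedler scale F r"
proof -
  let ?q = "sweedler free_scale (\<lambda>x y. pure2 (f x) (g y)) r"
  have "sweedler scale F r = sweedler scale F (tensor2_class s ?q)"
    using inv by (simp add: tensor2_map_def)
  also have "\<dots> = lin_ext scale (\<lambda>(x, y). F x y) ?q"
    by (rule sweedler_class[OF F])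
  also have "\<dots> = sweedler scale (\<lambda>x y. F (f x) (g y)) r"
    by (simp add: sweedler_linear_image[OF linear_lin_ext] pure2_def)
  finally show ?thesis by simp
qed

text \<open>The linear extension of \<open>T\<close> kills the generators of
  \<open>tensor3_null\<close>, hence factors through the triple tensor product. This is how elements
  of \<open>A\<close> and \<open>M\<close> get inserted into the Yang-Baxter equation.\<close>

lemma lin_ext_tensor3_class_eq:
  assumes T: "trilinear_map s scale T" and eq: "tensor3_class s p = tensor3_class s q"
  shows "lin_ext scale (\<lambda>(x, y, z). T x y z) p = lin_ext scale (\<lambda>(x, y, z). T x y z) q"
proof -
  let ?L = "lin_ext scale (\<lambda>(x, y, z). T x y z)"
  interpret L: Vector_Spaces.linear free_scale scale ?L by (rule linear_lin_ext)
  have l: "Vector_Spaces.linear s scale (\<lambda>x. T x y z)" "Vector_Spaces.linear s scale (\<lambda>y. T x y z)"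
    "Vector_Spaces.linear s scale (T x y)" for x y z
    using T by (auto simp: trilinear_map_def)
  have "free_vs.subspace {p. ?L p \<in> {0}}"
    by (rule L.subspace_linear_preimage) simp
  then have "tensor3_null s \<subseteq> {p. ?L p \<in> {0}}"
    unfolding tensor3_null_def using l
    by (intro free_vs.span_minimal)
      (auto simp: pure3_def L.diff L.scale Vector_Spaces.linear_iff)
  moreover have "p \<in> tensor3_class s p"
    by (simp add: tensor3_class_def tensor3_null_def free_vs.span_zero)
  then have "p - q \<in> tensor3_null s"
    using eq unfolding tensor3_class_def by blast
  ultimately have "?L (p - q) = 0" by auto
  then show ?thesis by (simp add: L.diff)
qed

end

section \<open>The common setting and the untwisted products\<close>

locale quasitriangular_bimodule =
  Q: quasitriangular_infBH_bialgebra lam scaleA mult e \<alpha>A \<beta>A \<psi> \<omega> r +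
  bihom_bimodule scaleA mult \<alpha>A \<beta>A scaleM lact ract \<alpha>M \<beta>M
  for lam :: "'k::field"
    and scaleA :: "'k \<Rightarrow> 'a::ab_group_add \<Rightarrow> 'a"
    and mult :: "'a \<Rightarrow> 'a \<Rightarrow> 'a" (infixl \<open>\<cdot>\<close> 70)
    and e :: 'a
    and \<alpha>A \<beta>A \<psi> \<omega> :: "'a \<Rightarrow> 'a"
    and r :: "('a \<times> 'a \<Rightarrow>\<^sub>0 'k) set"
    and scaleM :: "'k \<Rightarrow> 'm::ab_group_add \<Rightarrow> 'm"
    and lact :: "'a \<Rightarrow> 'm \<Rightarrow> 'm" (infixr \<open>\<triangleright>\<close> 70)
    and ract :: "'m \<Rightarrow> 'a \<Rightarrow> 'm" (infixl \<open>\<triangleleft>\<close> 70)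
    and \<alpha>M \<beta>M :: "'m \<Rightarrow> 'm" +
  assumes \<alpha>M_bij: "bij \<alpha>M" and \<beta>M_bij: "bij \<beta>M"
begin

text \<open>The unit need not act on \<open>M\<close> as the identity, not even after untwisting.\<close>

definition amul (infixl \<open>\<star>\<close> 70) where "a \<star> b = inv \<alpha>A a \<cdot> inv \<beta>A b"
definition lmul (infixr \<open>\<rhd>\<close> 70) where "a \<rhd> m = inv \<alpha>A a \<triangleright> inv \<beta>M m"
definition rmul (infixl \<open>\<lhd>\<close> 70) where "m \<lhd> a = inv \<alpha>M m \<triangleleft> inv \<beta>A a"

definition RA where
  "RA a = - sweedler scaleA (\<lambda>r1 r2. \<beta>A (\<beta>A (\<psi> r1)) \<cdot> (inv \<alpha>A (inv \<beta>A a) \<cdot> \<alpha>A (\<omega> r2))) r"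
definition RM where
  "RM m = - sweedler scaleM (\<lambda>r1 r2. \<beta>A (\<beta>A (\<psi> r1)) \<triangleright> (inv \<alpha>M (inv \<beta>M m) \<triangleleft> \<alpha>A (\<omega> r2))) r"

lemma inv_cancel [simp]:
  "inv \<alpha>A (\<alpha>A a) = a" "\<alpha>A (inv \<alpha>A a) = a" "inv \<beta>A (\<beta>A a) = a" "\<beta>A (inv \<beta>A a) = a"
  "inv \<alpha>M (\<alpha>M m) = m" "\<alpha>M (inv \<alpha>M m) = m" "inv \<beta>M (\<beta>M m) = m" "\<beta>M (inv \<beta>M m) = m"
  using Q.\<alpha>_bij Q.\<beta>_bij \<alpha>M_bij \<beta>M_bij
  by (simp_all add: bij_is_inj bij_is_surj surj_f_inv_f)

lemma vector_spaces: "vector_space scaleA" "vector_space scaleM"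
  by unfold_locales

lemmas linear_defs = bilinear_map_def trilinear_map_def Vector_Spaces.linear_iff

text \<open>Oriented towards a normal form for words in commuting maps: powers of \<beta> outermost,
  then powers of \<alpha>, with \<psi> and \<omega> innermost.\<close>

lemma twist_hom:
  "\<alpha>A (\<beta>A a) = \<beta>A (\<alpha>A a)" "\<alpha>M (\<beta>M m) = \<beta>M (\<alpha>M m)"
  "inv \<alpha>A (\<beta>A a) = \<beta>A (inv \<alpha>A a)" "\<alpha>A (inv \<beta>A a) = inv \<beta>A (\<alpha>A a)"
  "inv \<alpha>A (inv \<beta>A a) = inv \<beta>A (inv \<alpha>A a)"
  "inv \<alpha>M (\<beta>M m) = \<beta>M (inv \<alpha>M m)" "\<alpha>M (inv \<beta>M m) = inv \<beta>M (\<alpha>M m)"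
  "inv \<alpha>M (inv \<beta>M m) = inv \<beta>M (inv \<alpha>M m)"
  "\<psi> (\<alpha>A a) = \<alpha>A (\<psi> a)" "\<psi> (\<beta>A a) = \<beta>A (\<psi> a)"
  "\<omega> (\<alpha>A a) = \<alpha>A (\<omega> a)" "\<omega> (\<beta>A a) = \<beta>A (\<omega> a)"
  "\<psi> (inv \<alpha>A a) = inv \<alpha>A (\<psi> a)" "\<psi> (inv \<beta>A a) = inv \<beta>A (\<psi> a)"
  "\<omega> (inv \<alpha>A a) = inv \<alpha>A (\<omega> a)" "\<omega> (inv \<beta>A a) = inv \<beta>A (\<omega> a)"
  by (metis inv_cancel Q.\<alpha>_\<beta>_commute \<alpha>M_\<beta>M_commute Q.\<psi>_\<alpha>_commute Q.\<psi>_\<beta>_commute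
      Q.\<omega>_\<alpha>_commute Q.\<omega>_\<beta>_commute)+

lemma inv_hom:
  "inv \<alpha>A (a \<cdot> b) = inv \<alpha>A a \<cdot> inv \<alpha>A b" "inv \<beta>A (a \<cdot> b) = inv \<beta>A a \<cdot> inv \<beta>A b"
  "inv \<alpha>M (a \<triangleright> m) = inv \<alpha>A a \<triangleright> inv \<alpha>M m" "inv \<beta>M (a \<triangleright> m) = inv \<beta>A a \<triangleright> inv \<beta>M m"
  "inv \<alpha>M (m \<triangleleft> a) = inv \<alpha>M m \<triangleleft> inv \<alpha>A a" "inv \<beta>M (m \<triangleleft> a) = inv \<beta>M m \<triangleleft> inv \<beta>A a"
  by (metis inv_cancel Q.\<alpha>_mult Q.\<beta>_mult \<alpha>M_lact \<beta>M_lact \<alpha>M_ract \<beta>M_ract)+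

lemma mul_untwist:
  "a \<cdot> b = \<alpha>A a \<star> \<beta>A b" "a \<triangleright> m = \<alpha>A a \<rhd> \<beta>M m" "m \<triangleleft> a = \<alpha>M m \<lhd> \<beta>A a"
  by (simp_all add: amul_def lmul_def rmul_def)

text \<open>Each BiHom axiom, taken at arguments twisted by \<alpha>^-2, \<alpha>^-1 \<beta>^-1 and
  \<beta>^-2 in this order, loses its twisting maps. Read from left to right, the equations turn
  left factors into iterated left actions and gather right factors into one product.\<close>

lemma mul_assoc:
  "a \<star> b \<star> c = a \<star> (b \<star> c)" "(a \<star> b) \<rhd> m = a \<rhd> b \<rhd> m"
  "m \<lhd> a \<lhd> b = m \<lhd> (a \<star> b)" "(a \<rhd> m) \<lhd> b = a \<rhd> (m \<lhd> b)"
proof -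
  show "a \<star> b \<star> c = a \<star> (b \<star> c)"
    using Q.bihom_assoc[of "inv \<alpha>A (inv \<alpha>A a)" "inv \<alpha>A (inv \<beta>A b)" "inv \<beta>A (inv \<beta>A c)"]
    by (simp add: amul_def inv_hom twist_hom)
  show "(a \<star> b) \<rhd> m = a \<rhd> b \<rhd> m"
    using lact_lact[of "inv \<alpha>A (inv \<alpha>A a)" "inv \<alpha>A (inv \<beta>A b)" "inv \<beta>M (inv \<beta>M m)"]
    by (simp add: amul_def lmul_def inv_hom twist_hom)
  show "m \<lhd> a \<lhd> b = m \<lhd> (a \<star> b)"
    using ract_ract[of "inv \<alpha>M (inv \<alpha>M m)" "inv \<alpha>A (inv \<beta>A a)" "inv \<beta>A (inv \<beta>A b)"]
    by (simp add: amul_def rmul_def inv_hom twist_hom)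
  show "(a \<rhd> m) \<lhd> b = a \<rhd> (m \<lhd> b)"
    using lact_ract[of "inv \<alpha>A (inv \<alpha>A a)" "inv \<alpha>M (inv \<beta>M m)" "inv \<beta>A (inv \<beta>A b)"]
    by (simp add: lmul_def rmul_def inv_hom twist_hom)
qed

lemma unit_mul: "e \<star> a = a" "a \<star> e = a"
proof -
  have "inv \<alpha>A e = e" "inv \<beta>A e = e"
    by (metis inv_cancel Q.\<alpha>_unit, metis inv_cancel Q.\<beta>_unit)
  then show "e \<star> a = a" "a \<star> e = a"
    by (simp_all add: amul_def Q.mult_unit_left Q.mult_unit_right)
qed

lemma mul_hom:
  "\<alpha>A (a \<star> b) = \<alpha>A a \<star> \<alpha>A b" "\<beta>A (a \<star> b) = \<beta>A a \<star> \<beta>A b"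
  "\<psi> (a \<star> b) = \<psi> a \<star> \<psi> b" "\<omega> (a \<star> b) = \<omega> a \<star> \<omega> b"
  "\<alpha>M (a \<rhd> m) = \<alpha>A a \<rhd> \<alpha>M m" "\<beta>M (a \<rhd> m) = \<beta>A a \<rhd> \<beta>M m"
  "\<alpha>M (m \<lhd> a) = \<alpha>M m \<lhd> \<alpha>A a" "\<beta>M (m \<lhd> a) = \<beta>M m \<lhd> \<beta>A a"
  by (simp_all add: amul_def lmul_def rmul_def Q.\<alpha>_mult Q.\<beta>_mult Q.\<psi>_mult Q.\<omega>_mult
      \<alpha>M_lact \<beta>M_lact \<alpha>M_ract \<beta>M_ract twist_hom)

section \<open>Linearity of the structure maps, products and Sweedler sums\<close>

lemma maps_additive:
  "\<alpha>A (a + b) = \<alpha>A a + \<alpha>A b" "\<beta>A (a + b) = \<beta>A a + \<beta>A b"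
  "\<psi> (a + b) = \<psi> a + \<psi> b" "\<omega> (a + b) = \<omega> a + \<omega> b"
  "\<alpha>M (m + n) = \<alpha>M m + \<alpha>M n" "\<beta>M (m + n) = \<beta>M m + \<beta>M n"
  "\<alpha>A (scaleA c a) = scaleA c (\<alpha>A a)" "\<beta>A (scaleA c a) = scaleA c (\<beta>A a)"
  "\<psi> (scaleA c a) = scaleA c (\<psi> a)" "\<omega> (scaleA c a) = scaleA c (\<omega> a)"
  "\<alpha>M (scaleM c m) = scaleM c (\<alpha>M m)" "\<beta>M (scaleM c m) = scaleM c (\<beta>M m)"
  using Q.\<alpha>_linear Q.\<beta>_linear Q.\<psi>_linear Q.\<omega>_linear \<alpha>M_linear \<beta>M_linear
  by (simp_all add: Vector_Spaces.linear_iff)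

lemma inv_additive:
  "inv \<alpha>A (a + b) = inv \<alpha>A a + inv \<alpha>A b" "inv \<beta>A (a + b) = inv \<beta>A a + inv \<beta>A b"
  "inv \<alpha>M (m + n) = inv \<alpha>M m + inv \<alpha>M n" "inv \<beta>M (m + n) = inv \<beta>M m + inv \<beta>M n"
  "inv \<alpha>A (scaleA c a) = scaleA c (inv \<alpha>A a)" "inv \<beta>A (scaleA c a) = scaleA c (inv \<beta>A a)"
  "inv \<alpha>M (scaleM c m) = scaleM c (inv \<alpha>M m)" "inv \<beta>M (scaleM c m) = scaleM c (inv \<beta>M m)"
  by (metis inv_cancel maps_additive)+

lemma mul_additive:
  "(a + a') \<star> b = a \<star> b + a' \<star> b" "a \<star> (b + b') = a \<star> b + a \<star> b'"
  "(a + a') \<rhd> m = a \<rhd> m + a' \<rhd> m" "a \<rhd> (m + m') = a \<rhd> m + a \<rhd> m'"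
  "(m + m') \<lhd> a = m \<lhd> a + m' \<lhd> a" "m \<lhd> (a + a') = m \<lhd> a + m \<lhd> a'"
  "scaleA c a \<star> b = scaleA c (a \<star> b)" "a \<star> scaleA c b = scaleA c (a \<star> b)"
  "scaleA c a \<rhd> m = scaleM c (a \<rhd> m)" "a \<rhd> scaleM c m = scaleM c (a \<rhd> m)"
  "scaleM c m \<lhd> a = scaleM c (m \<lhd> a)" "m \<lhd> scaleA c a = scaleM c (m \<lhd> a)"
  using Q.mult_bilinear lact_bilinear ract_bilinear
  by (simp_all add: linear_defs amul_def lmul_def rmul_def inv_additive)

lemmas sweedler_additive =
  Q.sweedler_add Q.sweedler_scale M.sweedler_add M.sweedler_scale

text \<open>These settle linearity in each variable for any map composed of products, structure maps
  and Sweedler sums; the rules for sums are what nested copies of \<open>r\<close> require.\<close>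

lemmas linear_simps =
  linear_defs vector_spaces maps_additive mul_additive sweedler_additive

lemma mul_uminus:
  "(- a) \<star> b = - (a \<star> b)" "a \<star> (- b) = - (a \<star> b)"
  "(- a) \<rhd> m = - (a \<rhd> m)" "a \<rhd> (- m) = - (a \<rhd> m)"
  "(- m) \<lhd> a = - (m \<lhd> a)" "m \<lhd> (- a) = - (m \<lhd> a)"
  "\<alpha>M (- m) = - \<alpha>M m" "\<beta>M (- m) = - \<beta>M m"
  "\<alpha>A (- a) = - \<alpha>A a" "\<beta>A (- a) = - \<beta>A a"
  using mul_additive(7-12)[where c = "-1"] maps_additive(7,8,11,12)[where c = "-1"] by simp_all

lemma sweedler_mul:
  "sweedler scaleA F r \<star> b = sweedler scaleA (\<lambda>x y. F x y \<star> b) r"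
  "a \<star> sweedler scaleA F r = sweedler scaleA (\<lambda>x y. a \<star> F x y) r"
  "sweedler scaleA F r \<rhd> m = sweedler scaleM (\<lambda>x y. F x y \<rhd> m) r"
  "a \<rhd> sweedler scaleM G r = sweedler scaleM (\<lambda>x y. a \<rhd> G x y) r"
  "sweedler scaleM G r \<lhd> a = sweedler scaleM (\<lambda>x y. G x y \<lhd> a) r"
  "m \<lhd> sweedler scaleA F r = sweedler scaleM (\<lambda>x y. m \<lhd> F x y) r"
  "\<alpha>M (sweedler scaleM G r) = sweedler scaleM (\<lambda>x y. \<alpha>M (G x y)) r"
  "\<beta>M (sweedler scaleM G r) = sweedler scaleM (\<lambda>x y. \<beta>M (G x y)) r"
  "\<alpha>A (sweedler scaleA F r) = sweedler scaleA (\<lambda>x y. \<alpha>A (F x y)) r"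
  "\<beta>A (sweedler scaleA F r) = sweedler scaleA (\<lambda>x y. \<beta>A (F x y)) r"
  by (rule sweedler_linear_image; simp add: linear_simps)+

section \<open>Invariance of \<open>r\<close> and the untwisted Yang-Baxter equation\<close>

lemma r_invariant_A:
  assumes "bilinear_map scaleA scaleA scaleA F"
  shows "sweedler scaleA (\<lambda>x y. F (\<alpha>A x) (\<alpha>A y)) r = sweedler scaleA F r"
    "sweedler scaleA (\<lambda>x y. F (\<beta>A x) (\<beta>A y)) r = sweedler scaleA F r"
  using Q.sweedler_invariant[OF _ assms] Q.r_\<alpha>_invariant Q.r_\<beta>_invariant
  by auto

lemma r_invariant_M:
  assumes "bilinear_map scaleA scaleA scaleM F"
  shows "sweedler scaleM (\<lambda>x y. F (\<alpha>A x) (\<alpha>A y)) r = sweedler scaleM F r"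
    "sweedler scaleM (\<lambda>x y. F (\<beta>A x) (\<beta>A y)) r = sweedler scaleM F r"
    "sweedler scaleM (\<lambda>x y. F (\<psi> x) (\<psi> y)) r = sweedler scaleM F r"
    "sweedler scaleM (\<lambda>x y. F (\<omega> x) (\<omega> y)) r = sweedler scaleM F r"
  using M.sweedler_invariant[OF _ assms] Q.r_\<alpha>_invariant Q.r_\<beta>_invariant
    Q.r_\<psi>_invariant Q.r_\<omega>_invariant
  by auto

text \<open>Evaluate the Yang-Baxter equation with \<open>T\<close> and untwist its products. Each
  copy of \<open>r\<close> on the left then carries the same map, \<alpha> or \<beta>, on both
  factors, and invariance removes it. The maps \<omega> and \<psi> stay, since they sit on different
  factors.\<close>

lemma yang_baxter_untwisted:
  assumes T: "trilinear_map scaleA scaleM T"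
  shows "sweedler scaleM (\<lambda>x y. sweedler scaleM (\<lambda>x' y'. T (\<omega> x \<star> x') y' (\<psi> y)) r) r
    - sweedler scaleM (\<lambda>x y. sweedler scaleM (\<lambda>x' y'. T x (y \<star> x') y') r) r
    + sweedler scaleM (\<lambda>x y. sweedler scaleM (\<lambda>x' y'. T (\<omega> x) x' (y' \<star> \<psi> y)) r) r
    = scaleM lam (sweedler scaleM (\<lambda>x y. T (\<omega> x) e (\<psi> y)) r)"
    (is "?S1 - ?S2 + ?S3 = _")
proof -
  let ?L = "lin_ext scaleM (\<lambda>(x, y, z). T x y z)"
  interpret L: Vector_Spaces.linear free_scale scaleM ?L by (rule M.linear_lin_ext)
  \<comment> \<open>Partially applied, since the simplifier eta-contracts \<open>\<lambda>z. T x y z\<close>.\<close>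
  have T_add: "T (x + x') y = (\<lambda>z. T x y z + T x' y z)"
    "T x (y + y') = (\<lambda>z. T x y z + T x y' z)"
    "T x y (z + z') = T x y z + T x y z'"
    "T (scaleA c x) y = (\<lambda>z. scaleM c (T x y z))" "T x (scaleA c y) = (\<lambda>z. scaleM c (T x y z))"
    "T x y (scaleA c z) = scaleM c (T x y z)" for x x' y y' z z' c
    using T by (simp_all add: linear_defs fun_eq_iff)
  have "sweedler scaleM (\<lambda>x y. sweedler scaleM (\<lambda>x' y'.
      T (\<omega> x \<cdot> x') (\<beta>A y') (\<alpha>A (\<psi> y)) - T (\<alpha>A x) (y \<cdot> x') (\<beta>A y')
      + T (\<beta>A (\<omega> x)) (\<alpha>A x') (y' \<cdot> \<psi> y)) r) r
    = scaleM lam (sweedler scaleM (\<lambda>x y. T (\<omega> x) e (\<psi> y)) r)"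
    using M.lin_ext_tensor3_class_eq[OF T Q.yang_baxter]
    by (simp add: sweedler_linear_image[OF M.linear_lin_ext] L.add L.diff L.scale pure3_def)
  then have "sweedler scaleM (\<lambda>x y. sweedler scaleM (\<lambda>x' y'.
        T (\<omega> (\<alpha>A x) \<star> \<beta>A x') (\<beta>A y') (\<psi> (\<alpha>A y))) r) r
    - sweedler scaleM (\<lambda>x y. sweedler scaleM (\<lambda>x' y'. T (\<alpha>A x) (\<alpha>A y \<star> \<beta>A x') (\<beta>A y')) r) r
    + sweedler scaleM (\<lambda>x y. sweedler scaleM (\<lambda>x' y'.
        T (\<omega> (\<beta>A x)) (\<alpha>A x') (\<alpha>A y' \<star> \<psi> (\<beta>A y))) r) r
    = scaleM lam (sweedler scaleM (\<lambda>x y. T (\<omega> x) e (\<psi> y)) r)" (is "?S1' - ?S2' + ?S3' = _")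
    by (simp add: M.sweedler_add M.sweedler_diff mul_untwist twist_hom)
  moreover have "?S1' = ?S1"
    by (simp add: r_invariant_M(2)[of "\<lambda>x' y'. T (\<omega> (\<alpha>A _) \<star> x') y' (\<psi> (\<alpha>A _))"]
        r_invariant_M(1)[of "\<lambda>x y. sweedler scaleM (\<lambda>x' y'. T (\<omega> x \<star> x') y' (\<psi> y)) r"]
        linear_simps T_add)
  moreover have "?S2' = ?S2"
    by (simp add: r_invariant_M(2)[of "\<lambda>x' y'. T (\<alpha>A _) (\<alpha>A _ \<star> x') y'"]
        r_invariant_M(1)[of "\<lambda>x y. sweedler scaleM (\<lambda>x' y'. T x (y \<star> x') y') r"]
        linear_simps T_add)
  moreover have "?S3' = ?S3"
    by (simp add: r_invariant_M(1)[of "\<lambda>x' y'. T (\<omega> (\<beta>A _)) x' (y' \<star> \<psi> (\<beta>A _))"]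
        r_invariant_M(2)[of "\<lambda>x y. sweedler scaleM (\<lambda>x' y'. T (\<omega> x) x' (y' \<star> \<psi> y)) r"]
        linear_simps T_add)
  ultimately show ?thesis by simp
qed

section \<open>The operators in untwisted form, and absorbing \<psi> and \<omega> into
  \<open>r\<close>\<close>

lemma RA_untwisted: "RA a = - sweedler scaleA (\<lambda>x y. \<psi> x \<star> (a \<star> \<omega> y)) r"
proof -
  \<comment> \<open>The powers of \<alpha> and \<beta> in the definition are balanced: untwisting
    leaves \<open>a\<close> bare and puts \<alpha> \<beta>^2 on both factors of \<open>r\<close>,
    where three uses of invariance remove it.\<close>
  have "RA a = - sweedler scaleA (\<lambda>x y. \<psi> (\<alpha>A (\<beta>A (\<beta>A x))) \<star> (a \<star> \<omega> (\<alpha>A (\<beta>A (\<beta>A y))))) r"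
    by (simp add: RA_def mul_untwist mul_hom twist_hom)
  also have "\<dots> = - sweedler scaleA (\<lambda>x y. \<psi> x \<star> (a \<star> \<omega> y)) r"
    by (simp add: r_invariant_A(1)[of "\<lambda>x y. \<psi> x \<star> (a \<star> \<omega> y)"]
        r_invariant_A(2)[of "\<lambda>x y. \<psi> (\<alpha>A x) \<star> (a \<star> \<omega> (\<alpha>A y))"]
        r_invariant_A(2)[of "\<lambda>x y. \<psi> (\<alpha>A (\<beta>A x)) \<star> (a \<star> \<omega> (\<alpha>A (\<beta>A y)))"] linear_simps)
  finally show ?thesis .
qed

lemma RM_untwisted: "RM m = - sweedler scaleM (\<lambda>x y. \<psi> x \<rhd> (m \<lhd> \<omega> y)) r"
proof -
  have "RM m = - sweedler scaleM (\<lambda>x y. \<psi> (\<alpha>A (\<beta>A (\<beta>A x))) \<rhd> (m \<lhd> \<omega> (\<alpha>A (\<beta>A (\<beta>A y))))) r"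
    by (simp add: RM_def mul_untwist mul_hom twist_hom)
  also have "\<dots> = - sweedler scaleM (\<lambda>x y. \<psi> x \<rhd> (m \<lhd> \<omega> y)) r"
    by (simp add: r_invariant_M(1)[of "\<lambda>x y. \<psi> x \<rhd> (m \<lhd> \<omega> y)"]
        r_invariant_M(2)[of "\<lambda>x y. \<psi> (\<alpha>A x) \<rhd> (m \<lhd> \<omega> (\<alpha>A y))"]
        r_invariant_M(2)[of "\<lambda>x y. \<psi> (\<alpha>A (\<beta>A x)) \<rhd> (m \<lhd> \<omega> (\<alpha>A (\<beta>A y)))"] linear_simps)
  finally show ?thesis .
qed

lemma RM_linear: "Vector_Spaces.linear scaleM scaleM RM"
  by (simp add: linear_simps RM_untwisted)

text \<open>Both twists are multiplicative for the untwisted product, so they reach \<open>a\<close>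
  and both factors of \<open>r\<close>; invariance absorbs the latter.\<close>

lemma RA_commute: "RA (\<alpha>A a) = \<alpha>A (RA a)" "RA (\<beta>A a) = \<beta>A (RA a)"
  using r_invariant_A(1)[of "\<lambda>x y. \<psi> x \<star> (\<alpha>A a \<star> \<omega> y)"]
    r_invariant_A(2)[of "\<lambda>x y. \<psi> x \<star> (\<beta>A a \<star> \<omega> y)"]
  by (simp_all add: RA_untwisted mul_uminus sweedler_mul mul_hom linear_simps twist_hom)

lemma RM_commute: "RM (\<alpha>M m) = \<alpha>M (RM m)" "RM (\<beta>M m) = \<beta>M (RM m)"
  using r_invariant_M(1)[of "\<lambda>x y. \<psi> x \<rhd> (\<alpha>M m \<lhd> \<omega> y)"]
    r_invariant_M(2)[of "\<lambda>x y. \<psi> x \<rhd> (\<beta>M m \<lhd> \<omega> y)"]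
  by (simp_all add: RM_untwisted mul_uminus sweedler_mul mul_hom linear_simps twist_hom)

text \<open>These are the pairs of maps that \<psi>\<psi> \<otimes> \<omega>\<psi> \<otimes>
  \<omega>\<omega> leaves on a copy of \<open>r\<close> in tensor places (1,2), (2,3) and (1,3); in
  the last case the equation itself supplies one more \<omega> and \<psi>. Each pair is (\<psi>,
  \<omega>) preceded on both factors by \<psi>, by \<omega>, or by their composite.\<close>

lemma r_shift_M:
  assumes "bilinear_map scaleA scaleA scaleM F"
  shows "sweedler scaleM (\<lambda>x y. F (\<psi> (\<psi> x)) (\<omega> (\<psi> y))) r =
      sweedler scaleM (\<lambda>x y. F (\<psi> x) (\<omega> y)) r"
    "sweedler scaleM (\<lambda>x y. F (\<omega> (\<psi> x)) (\<omega> (\<omega> y))) r =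
      sweedler scaleM (\<lambda>x y. F (\<psi> x) (\<omega> y)) r"
    "sweedler scaleM (\<lambda>x y. F (\<omega> (\<psi> (\<psi> x))) (\<omega> (\<omega> (\<psi> y)))) r =
      sweedler scaleM (\<lambda>x y. F (\<psi> x) (\<omega> y)) r"
proof -
  have F: "F (x + x') y = F x y + F x' y" "F x (y + y') = F x y + F x y'"
    "F (scaleA c x) y = scaleM c (F x y)" "F x (scaleA c y) = scaleM c (F x y)" for x x' y y' c
    using assms by (simp_all add: linear_defs)
  show 1: "sweedler scaleM (\<lambda>x y. F (\<psi> (\<psi> x)) (\<omega> (\<psi> y))) r =
      sweedler scaleM (\<lambda>x y. F (\<psi> x) (\<omega> y)) r"
    using r_invariant_M(3)[of "\<lambda>x y. F (\<psi> x) (\<omega> y)"] by (simp add: linear_simps F)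
  show "sweedler scaleM (\<lambda>x y. F (\<omega> (\<psi> x)) (\<omega> (\<omega> y))) r =
      sweedler scaleM (\<lambda>x y. F (\<psi> x) (\<omega> y)) r"
    using r_invariant_M(4)[of "\<lambda>x y. F (\<psi> x) (\<omega> y)"]
    by (simp add: linear_simps F Q.\<psi>_\<omega>_commute)
  show "sweedler scaleM (\<lambda>x y. F (\<omega> (\<psi> (\<psi> x))) (\<omega> (\<omega> (\<psi> y)))) r =
      sweedler scaleM (\<lambda>x y. F (\<psi> x) (\<omega> y)) r"
    using r_invariant_M(4)[of "\<lambda>x y. F (\<psi> (\<psi> x)) (\<omega> (\<psi> y))"]
    by (simp add: 1 linear_simps F Q.\<psi>_\<omega>_commute)
qed

section \<open>The Rota-Baxter identities\<close>

lemma rota_baxter_left_untwisted: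
  "RA a \<rhd> RM m = RM (a \<rhd> RM m) + RM (RA a \<rhd> m) + scaleM lam (RM (a \<rhd> m))"
proof -
  \<comment> \<open>\<open>a\<close> goes between the first two tensor factors and \<open>m\<close>
    between the last two. The three Yang-Baxter terms become \<open>RM (RA a \<rhd> m)\<close>,
    \<open>RA a \<rhd> RM m\<close> and \<open>RM (a \<rhd> RM m)\<close>.\<close>
  let ?T = "\<lambda>u v w. \<psi> (\<psi> u) \<rhd> a \<rhd> \<omega> (\<psi> v) \<rhd> (m \<lhd> \<omega> (\<omega> w))"
  let ?S = "\<lambda>F. sweedler scaleM F r"
  let ?X1 = "?S (\<lambda>x y. ?S (\<lambda>x' y'. \<psi> x \<rhd> \<psi> x' \<rhd> a \<rhd> \<omega> y' \<rhd> (m \<lhd> \<omega> y)))"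
  let ?X2 = "?S (\<lambda>x y. ?S (\<lambda>x' y'. \<psi> x \<rhd> a \<rhd> \<omega> y \<rhd> \<psi> x' \<rhd> (m \<lhd> \<omega> y')))"
  let ?X3 = "?S (\<lambda>x y. ?S (\<lambda>x' y'. \<psi> x \<rhd> a \<rhd> \<psi> x' \<rhd> (m \<lhd> (\<omega> y' \<star> \<omega> y))))"
  let ?X4 = "?S (\<lambda>x y. \<psi> x \<rhd> a \<rhd> (m \<lhd> \<omega> y))"
  have "trilinear_map scaleA scaleM ?T"
    by (simp add: linear_simps)
  note yb = yang_baxter_untwisted[OF this]
  have 1: "?S (\<lambda>x y. ?S (\<lambda>x' y'. ?T (\<omega> x \<star> x') y' (\<psi> y))) = ?X1"
    by (simp add: mul_hom mul_assoc Q.\<psi>_\<omega>_commute linear_simps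
        r_shift_M(1)[of "\<lambda>x' y'. _ \<rhd> x' \<rhd> a \<rhd> y' \<rhd> (m \<lhd> _)"]
        r_shift_M(3)[of "\<lambda>x y. ?S (\<lambda>x' y'. x \<rhd> \<psi> x' \<rhd> a \<rhd> \<omega> y' \<rhd> (m \<lhd> y))"])
  have 2: "?S (\<lambda>x y. ?S (\<lambda>x' y'. ?T x (y \<star> x') y')) = ?X2"
    by (simp add: mul_hom mul_assoc Q.\<psi>_\<omega>_commute linear_simps
        r_shift_M(2)[of "\<lambda>x' y'. _ \<rhd> a \<rhd> _ \<rhd> x' \<rhd> (m \<lhd> y')"]
        r_shift_M(1)[of "\<lambda>x y. ?S (\<lambda>x' y'. x \<rhd> a \<rhd> y \<rhd> \<psi> x' \<rhd> (m \<lhd> \<omega> y'))"])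
  have 3: "?S (\<lambda>x y. ?S (\<lambda>x' y'. ?T (\<omega> x) x' (y' \<star> \<psi> y))) = ?X3"
    by (simp add: mul_hom mul_assoc Q.\<psi>_\<omega>_commute linear_simps
        r_shift_M(2)[of "\<lambda>x' y'. _ \<rhd> a \<rhd> x' \<rhd> (m \<lhd> (y' \<star> _))"]
        r_shift_M(3)[of "\<lambda>x y. ?S (\<lambda>x' y'. x \<rhd> a \<rhd> \<psi> x' \<rhd> (m \<lhd> (\<omega> y' \<star> y)))"])
  \<comment> \<open>The unit may act nontrivially on \<open>M\<close>, but here it is absorbed by
    its left neighbour \<open>a\<close> inside \<open>A\<close>.\<close>
  have e: "a \<rhd> e \<rhd> n = a \<rhd> n" for n
    by (metis mul_assoc(2) unit_mul(2))
  have 4: "?S (\<lambda>x y. ?T (\<omega> x) e (\<psi> y)) = ?X4"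
    by (simp add: e Q.\<psi>_\<omega>_commute Q.\<psi>_unit Q.\<omega>_unit linear_simps
        r_shift_M(3)[of "\<lambda>x y. x \<rhd> a \<rhd> (m \<lhd> y)"])
  have "RA a \<rhd> RM m = - ?S (\<lambda>x y. \<psi> x \<rhd> a \<rhd> \<omega> y \<rhd> RM m)"
    by (simp add: RA_untwisted mul_uminus sweedler_mul mul_assoc)
  then have "RA a \<rhd> RM m = ?X2"
    by (simp add: RM_untwisted mul_uminus sweedler_mul M.sweedler_uminus)
  moreover have "?X1 - ?X2 + ?X3 = scaleM lam ?X4"
    using yb unfolding 1 2 3 4 .
  \<comment> \<open>Two operators give signs that cancel; the single operator in the last term keeps
    its sign, which makes the \<lambda>-term positive.\<close>
  moreover have "RM (a \<rhd> RM m) = ?X3" "RM (RA a \<rhd> m) = ?X1" "RM (a \<rhd> m) = - ?X4"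
    by (simp_all add: RM_untwisted RA_untwisted mul_uminus sweedler_mul
        M.sweedler_uminus mul_assoc)
  ultimately show ?thesis by (simp add: algebra_simps)
qed

lemma rota_baxter_right_untwisted:
  "RM m \<lhd> RA a = RM (m \<lhd> RA a) + RM (RM m \<lhd> a) + scaleM lam (RM (m \<lhd> a))"
proof -
  \<comment> \<open>Now \<open>m\<close> comes before \<open>a\<close>: the terms become
    \<open>RM (RM m \<lhd> a)\<close>, \<open>RM m \<lhd> RA a\<close> and
    \<open>RM (m \<lhd> RA a)\<close>, and the unit is absorbed by \<open>a\<close> on its
    right.\<close>
  let ?T = "\<lambda>u v w. \<psi> (\<psi> u) \<rhd> (m \<lhd> (\<omega> (\<psi> v) \<star> (a \<star> \<omega> (\<omega> w))))"
  let ?S = "\<lambda>F. sweedler scaleM F r"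
  let ?X1 = "?S (\<lambda>x y. ?S (\<lambda>x' y'. \<psi> x \<rhd> \<psi> x' \<rhd> (m \<lhd> (\<omega> y' \<star> (a \<star> \<omega> y)))))"
  let ?X2 = "?S (\<lambda>x y. ?S (\<lambda>x' y'. \<psi> x \<rhd> (m \<lhd> (\<omega> y \<star> (\<psi> x' \<star> (a \<star> \<omega> y'))))))"
  let ?X3 = "?S (\<lambda>x y. ?S (\<lambda>x' y'. \<psi> x \<rhd> (m \<lhd> (\<psi> x' \<star> (a \<star> (\<omega> y' \<star> \<omega> y))))))"
  let ?X4 = "?S (\<lambda>x y. \<psi> x \<rhd> (m \<lhd> (a \<star> \<omega> y)))"
  have "trilinear_map scaleA scaleM ?T"
    by (simp add: linear_simps)
  note yb = yang_baxter_untwisted[OF this]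
  have 1: "?S (\<lambda>x y. ?S (\<lambda>x' y'. ?T (\<omega> x \<star> x') y' (\<psi> y))) = ?X1"
    by (simp add: mul_hom mul_assoc Q.\<psi>_\<omega>_commute linear_simps
        r_shift_M(1)[of "\<lambda>x' y'. _ \<rhd> x' \<rhd> (m \<lhd> (y' \<star> (a \<star> _)))"]
        r_shift_M(3)[of "\<lambda>x y. ?S (\<lambda>x' y'. x \<rhd> \<psi> x' \<rhd> (m \<lhd> (\<omega> y' \<star> (a \<star> y))))"])
  have 2: "?S (\<lambda>x y. ?S (\<lambda>x' y'. ?T x (y \<star> x') y')) = ?X2"
    by (simp add: mul_hom mul_assoc Q.\<psi>_\<omega>_commute linear_simps
        r_shift_M(2)[of "\<lambda>x' y'. _ \<rhd> (m \<lhd> (_ \<star> (x' \<star> (a \<star> y'))))"]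
        r_shift_M(1)[of "\<lambda>x y. ?S (\<lambda>x' y'. x \<rhd> (m \<lhd> (y \<star> (\<psi> x' \<star> (a \<star> \<omega> y')))))"])
  have 3: "?S (\<lambda>x y. ?S (\<lambda>x' y'. ?T (\<omega> x) x' (y' \<star> \<psi> y))) = ?X3"
    by (simp add: mul_hom mul_assoc Q.\<psi>_\<omega>_commute linear_simps
        r_shift_M(2)[of "\<lambda>x' y'. _ \<rhd> (m \<lhd> (x' \<star> (a \<star> (y' \<star> _))))"]
        r_shift_M(3)[of "\<lambda>x y. ?S (\<lambda>x' y'. x \<rhd> (m \<lhd> (\<psi> x' \<star> (a \<star> (\<omega> y' \<star> y)))))"])
  have 4: "?S (\<lambda>x y. ?T (\<omega> x) e (\<psi> y)) = ?X4"
    by (simp add: unit_mul Q.\<psi>_\<omega>_commute Q.\<psi>_unit Q.\<omega>_unit linear_simps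
        r_shift_M(3)[of "\<lambda>x y. x \<rhd> (m \<lhd> (a \<star> y))"])
  have "RM m \<lhd> RA a = - ?S (\<lambda>x y. \<psi> x \<rhd> (m \<lhd> (\<omega> y \<star> RA a)))"
    by (simp add: RM_untwisted mul_uminus sweedler_mul mul_assoc)
  then have "RM m \<lhd> RA a = ?X2"
    by (simp add: RA_untwisted mul_uminus sweedler_mul M.sweedler_uminus)
  moreover have "?X1 - ?X2 + ?X3 = scaleM lam ?X4"
    using yb unfolding 1 2 3 4 .
  moreover have "RM (m \<lhd> RA a) = ?X3" "RM (RM m \<lhd> a) = ?X1" "RM (m \<lhd> a) = - ?X4"
    by (simp_all add: RM_untwisted RA_untwisted mul_uminus sweedler_mul
        M.sweedler_uminus mul_assoc)
  ultimately show ?thesis by (simp add: algebra_simps)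
qed

text \<open>The original action of \<open>a\<close> on \<open>m\<close> is the untwisted action of
  \<alpha>(a) on \<beta>(m), and both operators commute with the twists.\<close>

lemma rota_baxter_left:
  "RA a \<triangleright> RM m = RM (a \<triangleright> RM m) + RM (RA a \<triangleright> m) + scaleM lam (RM (a \<triangleright> m))"
  using rota_baxter_left_untwisted[of "\<alpha>A a" "\<beta>M m"]
  by (simp add: mul_untwist RA_commute RM_commute)

lemma rota_baxter_right:
  "RM m \<triangleleft> RA a = RM (m \<triangleleft> RA a) + RM (RM m \<triangleleft> a) + scaleM lam (RM (m \<triangleleft> a))"
  using rota_baxter_right_untwisted[of "\<alpha>M m" "\<beta>A a"]
  by (simp add: mul_untwist RA_commute RM_commute)

end

section \<open>The regular bimodule and the conclusion\<close>

lemma quasitriangular_regular_bimodule: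
  assumes "quasitriangular_infBH_bialgebra lam scale mult e \<alpha> \<beta> \<psi> \<omega> r"
  shows "quasitriangular_bimodule lam scale mult e \<alpha> \<beta> \<psi> \<omega> r scale mult mult \<alpha> \<beta>"
proof -
  interpret quasitriangular_infBH_bialgebra lam scale mult e \<alpha> \<beta> \<psi> \<omega> r by fact
  show ?thesis
    \<comment> \<open>With both actions equal to \<open>mult\<close>, all three action axioms are
      instances of \<open>bihom_assoc\<close>.\<close>
    by (intro quasitriangular_bimodule.intro bihom_bimodule.intro bihom_bimodule_axioms.intro
        quasitriangular_bimodule_axioms.intro assms bihom_assoc_algebra_axioms vector_space_axioms
        mult_bilinear \<alpha>_linear \<beta>_linear \<alpha>_\<beta>_commute \<alpha>_mult \<beta>_mult bihom_assoc \<alpha>_bij \<beta>_bij)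
qed

theorem proposition2p27:
  fixes lam :: "'k::field"
    and scaleA :: "'k \<Rightarrow> 'a::ab_group_add \<Rightarrow> 'a"
    and mult :: "'a \<Rightarrow> 'a \<Rightarrow> 'a" (infixl \<open>\<cdot>\<close> 70)
    and e :: 'a
    and \<alpha>A \<beta>A \<psi>A \<omega>A :: "'a \<Rightarrow> 'a"
    and r :: "('a \<times> 'a \<Rightarrow>\<^sub>0 'k) set"
    and scaleM :: "'k \<Rightarrow> 'm::ab_group_add \<Rightarrow> 'm"
    and lact :: "'a \<Rightarrow> 'm \<Rightarrow> 'm" (infixr \<open>\<triangleright>\<close> 70)
    and ract :: "'m \<Rightarrow> 'a \<Rightarrow> 'm" (infixl \<open>\<triangleleft>\<close> 70)
    and \<alpha>M \<beta>M :: "'m \<Rightarrow> 'm"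
    and R\<^sub>A :: "'a \<Rightarrow> 'a"
    and R\<^sub>M :: "'m \<Rightarrow> 'm"
  assumes "quasitriangular_infBH_bialgebra lam scaleA mult e \<alpha>A \<beta>A \<psi>A \<omega>A r"
    and "bihom_bimodule scaleA mult \<alpha>A \<beta>A scaleM lact ract \<alpha>M \<beta>M"
    and "bij \<alpha>M" and "bij \<beta>M"
    and "\<And>a. R\<^sub>A a =
      - sweedler scaleA (\<lambda>r1 r2. \<beta>A (\<beta>A (\<psi>A r1)) \<cdot> (inv \<alpha>A (inv \<beta>A a) \<cdot> \<alpha>A (\<omega>A r2))) r"
    and "\<And>m. R\<^sub>M m =
      - sweedler scaleM (\<lambda>r1 r2. \<beta>A (\<beta>A (\<psi>A r1)) \<triangleright> (inv \<alpha>M (inv \<beta>M m) \<triangleleft> \<alpha>A (\<omega>A r2))) r"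
  shows "rota_baxter_bihom_algebra lam scaleA mult \<alpha>A \<beta>A R\<^sub>A \<and>
    rota_baxter_bihom_bimodule lam scaleA mult \<alpha>A \<beta>A R\<^sub>A scaleM lact ract \<alpha>M \<beta>M R\<^sub>M"
proof -
  \<comment> \<open>In \<open>S\<close> both operators are \<open>R\<^sub>A\<close>, so its left
    module identity is the Rota-Baxter identity of the algebra; \<open>B\<close> treats the given
    module.\<close>
  interpret S: quasitriangular_bimodule lam scaleA mult e \<alpha>A \<beta>A \<psi>A \<omega>A r scaleA mult mult \<alpha>A \<beta>A
    using assms(1) by (rule quasitriangular_regular_bimodule)
  interpret B: quasitriangular_bimodule lam scaleA mult e \<alpha>A \<beta>A \<psi>A \<omega>A r scaleM lact ract \<alpha>M \<beta>M
    using assms(1-4)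
    by (simp add: quasitriangular_bimodule_def quasitriangular_bimodule_axioms_def)
  have R: "S.RA = R\<^sub>A" "S.RM = R\<^sub>A" "B.RA = R\<^sub>A" "B.RM = R\<^sub>M"
    by (simp_all add: fun_eq_iff S.RA_def S.RM_def B.RA_def B.RM_def assms(5,6))
  \<comment> \<open>The bimodule axioms apply \<open>R\<^sub>M\<close> to a whole sum, whereas the
    identities proved above have it distributed over the summands.\<close>
  interpret L: Vector_Spaces.linear scaleM scaleM R\<^sub>M
    using B.RM_linear by (simp add: R)
  have alg: "rota_baxter_bihom_algebra lam scaleA mult \<alpha>A \<beta>A R\<^sub>A"
    by (intro rota_baxter_bihom_algebra.intro rota_baxter_bihom_algebra_axioms.intro
        bihom_bimodule.axioms(1)[OF assms(2)] S.RM_linear[unfolded R] S.RM_commute[unfolded R]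
        S.rota_baxter_left[unfolded R])
  have "rota_baxter_bihom_bimodule_axioms lam R\<^sub>A scaleM lact ract \<alpha>M \<beta>M R\<^sub>M"
    by (rule rota_baxter_bihom_bimodule_axioms.intro)
      (simp_all only: L.add L.scale B.RM_linear[unfolded R] B.RM_commute[unfolded R]
        B.rota_baxter_left[unfolded R] B.rota_baxter_right[unfolded R])
  with alg assms(2) show ?thesis
    by (simp add: rota_baxter_bihom_bimodule_def)
qed

end
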